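(* Let $p, q, r$ be state predicates, let $E$ be a program expression, $ES$ a set-valued program expression and $B$ a Boolean program expression, let $x$ be a program variable, and let $S, T$ be statements whose types make each composite and each correctness assertion below well-typed (with $h$ ranging over state predicates on the appropriate intermediate state space). Then: \[\begin{array}{lcl} \{|p|\}\ \mathsf{abort}\ \{|q, r|\} & \equiv & p = \mathsf{false}\\ \{|p|\}\ \mathsf{stop}\ \{|q, r|\} & \equiv & \mathsf{true}\\ \{|p|\}\ \mathsf{skip}\ \{|q, r|\} & \equiv & p \Rightarrow q\\ \{|p|\}\ \mathsf{raise}\ \{|q, r|\} & \equiv & \mathsf{true}\\ \{|p|\}\ x := E\ \{|q, r|\} & \equiv & \mathsf{def}\,E \wedge p \Rightarrow q[x \backslash \mathsf{val}\,E]\\ \{|p|\}\ x :\in ES\ \{|q, r|\} & \equiv & \mathsf{def}\,ES \wedge p \Rightarrow \forall x' \in \mathsf{val}\,ES \cdot q[x\backslash x']\\ \{|p|\}\ S ; T\ \{|q, r|\} & \equiv & \exists h \cdot \{|p|\}\ S\ \{|h, r|\} \wedge \{h\}\ T\ \{q, p\vee r\}\\ \{|p|\}\ \mathsf{try}\ S\ \mathsf{catch}\ T\ \{|q, r|\} & \equiv & \exists h \cdot \{p\}\ S\ \{q, h\} \wedge \{h\}\ T\ \{q, p \vee r\}\\ \{|p|\}\ S \sqcap T\ \{|q, r|\} & \equiv & \{|p|\}\ S\ \{|q, r|\} \wedge \{|p|\}\ T\ \{|q, r|\}\\ \{|p|\}\ \mathsf{if}\ B\ \mathsf{then}\ S\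 \mathsf{else}\ T\ \{|q, r|\} & \equiv & \{\mathsf{def}\,B \wedge \mathsf{val}\,B \wedge p\}\ S\ \{q, p\vee r\} \wedge \{\mathsf{def}\,B \wedge \neg\mathsf{val}\,B \wedge p\}\ T\ \{q, p\vee r\} \end{array}\] Here, between state predicates, "$u \Rightarrow v$" means the entailment $u \le v$, and $p=\mathsf{false}$ is equality of predicates.
   Context: A state predicate on a state space $\Sigma$ is a function $\Sigma \to Bool$; $\wedge,\vee,\neg,\Rightarrow$ are pointwise, $\mathsf{true},\mathsf{false}$ are constant predicates, and $u \le v$ iff $\forall \sigma.\ u\,\sigma \Rightarrow v\,\sigma$. A relation $\Delta \leftrightarrow \Sigma$ is a function $\Delta \to (\Sigma \to Bool)$. A predicate transformer of type $\mathcal P\Psi \times \mathcal P\Omega \to \mathcal P\Delta$ maps a normal postcondition $q$ on $\Psi$ and an exceptional postcondition $r$ on $\Omega$ to a precondition on $\Delta$; a statement is a monotonic one ($q\le q'$, $r\le r'$ imply $S(q,r)\le S(q',r')$). Definitions: $\mathsf{abort}(q,r)=\mathsf{false}$, $\mathsf{stop}(q,r)=\mathsf{true}$, $\mathsf{skip}(q,r)=q$, $\mathsf{raise}(q,r)=r$, $(S;T)(q,r)=S(T(q,r),r)$, $(S;\!;T)(q,r)=S(q,T(q,r))$, $(S\sqcap T)(q,r)=S(q,r)\wedge T(q,r)$, $\mathsf{try}\ S\ \mathsf{catch}\ T = S;\!;T$. Assumption: $[u,v](q,r) = (u\Rightarrow q)\wedge(v \Rightarrow r)$, $[u](q,r)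 = (u \Rightarrow q)$. Demonic update: $[Q](q,r)\,\delta = \forall\psi.\ Q\,\delta\,\psi \Rightarrow q\,\psi$. A program expression $E$ has a definedness predicate $\mathsf{def}\,E$ and a value $\mathsf{val}\,E$ (total function on states). With state space consisting of variables $x,y$, the relation $x := e$ is $\lambda(x,y).\lambda(x',y').\ x' = e(x,y) \wedge y'=y$ and $x :\in es$ is $\lambda(x,y).\lambda(x',y').\ x' \in es(x,y)\wedge y'=y$. Assignment: $x := E = [\mathsf{def}\,E, \neg\mathsf{def}\,E]; [x := \mathsf{val}\,E]$; $x :\in ES = [\mathsf{def}\,ES,\neg\mathsf{def}\,ES];[x :\in \mathsf{val}\,ES]$. Conditional: $\mathsf{if}\ B\ \mathsf{then}\ S\ \mathsf{else}\ T = [\mathsf{def}\,B,\neg\mathsf{def}\,B];(([\mathsf{val}\,B];S)\sqcap([\neg\mathsf{val}\,B];T))$. $q[x\backslash e]$ denotes substitution of $e$ for $x$ in $q$. Total correctness: $\{p\}\ S\ \{q,r\} \;\widehat=\; p \le S(q,r)$. Partial correctness (defined only when the exceptional state space of $S$ equals its initial state space): $\{|p|\}\ S\ \{|q,r|\} \;\widehat=\; p \le S(q, p \vee r)$. *)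

theory Defs
  imports Main
begin

unbundle lattice_syntax

text \<open>
  On state predicates the library lattice operations are pointwise: \<open>u \<sqinter> v\<close>, \<open>u \<squnion> v\<close>, \<open>- u\<close>,
  \<open>\<bottom>\<close>, \<open>\<top>\<close> are conjunction, disjunction, negation, false and true, and \<open>u \<le> v\<close> is entailment.
\<close>

type_synonym 'a pred = "'a \<Rightarrow> bool"

text \<open>
  \<open>('c, 'e, 'd) ptrans\<close>: final state space \<open>'c\<close>, exceptional state space \<open>'e\<close>, initial state
  space \<open>'d\<close>. The pair of postconditions is curried.
\<close>

type_synonym ('c, 'e, 'd) ptrans = "'c pred \<Rightarrow> 'e pred \<Rightarrow> 'd pred"

definition is_statement :: "('c, 'e, 'd) ptrans \<Rightarrow> bool" where
  "is_statement S \<longleftrightarrow> (\<forall>q q' r r'. q \<le> q' \<longrightarrow> r \<le> r' \<longrightarrow> S q r \<le> S q' r')"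

definition abort :: "('c, 'e, 'd) ptrans" where
  "abort q r = \<bottom>"

definition stop :: "('c, 'e, 'd) ptrans" where
  "stop q r = \<top>"

definition skip :: "('d, 'e, 'd) ptrans" where
  "skip q r = q"

definition raise :: "('c, 'd, 'd) ptrans" where
  "raise q r = r"

definition seq :: "('m, 'e, 'd) ptrans \<Rightarrow> ('c, 'e, 'm) ptrans \<Rightarrow> ('c, 'e, 'd) ptrans" where
  "seq S T q r = S (T q r) r"

definition exc_seq :: "('c, 'm, 'd) ptrans \<Rightarrow> ('c, 'e, 'm) ptrans \<Rightarrow> ('c, 'e, 'd) ptrans" where
  "exc_seq S T q r = S q (T q r)"

definition try_catch :: "('c, 'm, 'd) ptrans \<Rightarrow> ('c, 'e, 'm) ptrans \<Rightarrow> ('c, 'e, 'd) ptrans" where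
  "try_catch S T = exc_seq S T"

definition choice :: "('c, 'e, 'd) ptrans \<Rightarrow> ('c, 'e, 'd) ptrans \<Rightarrow> ('c, 'e, 'd) ptrans" where
  "choice S T q r = S q r \<sqinter> T q r"

definition assumption2 :: "'d pred \<Rightarrow> 'd pred \<Rightarrow> ('d, 'd, 'd) ptrans" where
  "assumption2 u v q r = (\<lambda>\<sigma>. (u \<sigma> \<longrightarrow> q \<sigma>) \<and> (v \<sigma> \<longrightarrow> r \<sigma>))"

definition assumption1 :: "'d pred \<Rightarrow> ('d, 'e, 'd) ptrans" where
  "assumption1 u q r = (\<lambda>\<sigma>. u \<sigma> \<longrightarrow> q \<sigma>)"

definition demonic_update :: "('d \<Rightarrow> 'c pred) \<Rightarrow> ('c, 'e, 'd) ptrans" where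
  "demonic_update Q q r = (\<lambda>\<delta>. \<forall>\<psi>. Q \<delta> \<psi> \<longrightarrow> q \<psi>)"

datatype ('d, 'v) pexpr = PExpr (pdef: "'d pred") (pval: "'d \<Rightarrow> 'v")

text \<open>
  For assignments the state is a pair: the first component is the value of the assigned variable
  \<open>x\<close>, the second one comprises all other variables \<open>y\<close>.
\<close>

definition assign_rel :: "('x \<times> 'y \<Rightarrow> 'x) \<Rightarrow> 'x \<times> 'y \<Rightarrow> ('x \<times> 'y) pred" where
  "assign_rel e = (\<lambda>(x, y) (x', y'). x' = e (x, y) \<and> y' = y)"

definition set_assign_rel :: "('x \<times> 'y \<Rightarrow> 'x set) \<Rightarrow> 'x \<times> 'y \<Rightarrow> ('x \<times> 'y) pred" where
  "set_assign_rel es = (\<lambda>(x, y) (x', y'). x' \<in> es (x, y) \<and> y' = y)"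

definition subst :: "('x \<times> 'y) pred \<Rightarrow> ('x \<times> 'y \<Rightarrow> 'x) \<Rightarrow> ('x \<times> 'y) pred" where
  "subst q e = (\<lambda>(x, y). q (e (x, y), y))"

definition assign :: "('x \<times> 'y, 'x) pexpr \<Rightarrow> ('x \<times> 'y, 'x \<times> 'y, 'x \<times> 'y) ptrans" where
  "assign E = seq (assumption2 (pdef E) (- pdef E)) (demonic_update (assign_rel (pval E)))"

definition set_assign :: "('x \<times> 'y, 'x set) pexpr \<Rightarrow> ('x \<times> 'y, 'x \<times> 'y, 'x \<times> 'y) ptrans" where
  "set_assign ES = seq (assumption2 (pdef ES) (- pdef ES)) (demonic_update (set_assign_rel (pval ES)))"

definition cond :: "('d, bool) pexpr \<Rightarrow> ('c, 'd, 'd) ptrans \<Rightarrow> ('c, 'd, 'd) ptrans \<Rightarrow> ('c, 'd, 'd) ptrans"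
  where
  "cond B S T = seq (assumption2 (pdef B) (- pdef B))
     (choice (seq (assumption1 (pval B)) S) (seq (assumption1 (- pval B)) T))"

definition total_correct :: "'d pred \<Rightarrow> ('c, 'e, 'd) ptrans \<Rightarrow> 'c pred \<Rightarrow> 'e pred \<Rightarrow> bool" where
  "total_correct p S q r \<longleftrightarrow> p \<le> S q r"

definition partial_correct :: "'d pred \<Rightarrow> ('c, 'd, 'd) ptrans \<Rightarrow> 'c pred \<Rightarrow> 'd pred \<Rightarrow> bool" where
  "partial_correct p S q r \<longleftrightarrow> p \<le> S q (p \<squnion> r)"

end

theory Submission
  imports Defs
begin

text \<open>Partial correctness is the inequality \<open>p \<le> S q (p \<squnion> r)\<close>:
  raising an exception is always acceptable in a state satisfying \<open>p\<close>. Each law comes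
  from evaluating the transformer at \<open>q\<close> and \<open>p \<squnion> r\<close>. An
  exception raised before any state change adds the obligation
  \<open>p \<le> p \<squnion> r\<close>, which is void; this settles \<open>raise\<close> and the
  undefined case of assignments and conditionals. For the two compositions,
  \<open>partial_correct_seq\<close> and \<open>partial_correct_try_catch\<close>, the intermediate
  predicate is the precondition \<open>T q (p \<squnion> r)\<close>, and monotonicity of
  \<open>S\<close> lets any other suitable \<open>h\<close> be replaced by it.\<close>

lemma partial_correct_abort: "partial_correct p abort q r \<longleftrightarrow> p = \<bottom>"
  by (simp add: partial_correct_def abort_def bot_unique)

lemma partial_correct_stop: "partial_correct p stop q r"
  by (simp add: partial_correct_def stop_def)

lemma partial_correct_skip: "partial_correct p skip q r \<longleftrightarrow> p \<le> q"
  by (simp add: partial_correct_def skip_def)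

lemma partial_correct_raise: "partial_correct p raise q r"
  by (simp add: partial_correct_def raise_def)

text \<open>Where \<open>E\<close> is undefined the assumption demands
  \<open>p \<squnion> r\<close>, which \<open>p\<close> supplies, so only states with
  \<open>pdef E\<close> matter. There the update has exactly one successor, and the one-point rule
  turns its quantifier into a substitution.\<close>

lemma partial_correct_assign:
  "partial_correct p (assign E) q r \<longleftrightarrow> pdef E \<sqinter> p \<le> subst q (pval E)"
  by (auto simp: partial_correct_def assign_def seq_def assumption2_def demonic_update_def
      assign_rel_def subst_def le_fun_def)

lemma partial_correct_set_assign:
  "partial_correct p (set_assign ES) q r \<longleftrightarrow>
     pdef ES \<sqinter> p \<le> (\<lambda>\<sigma>. \<forall>x' \<in> pval ES \<sigma>. subst q (\<lambda>_. x') \<sigma>)"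
  by (auto simp: partial_correct_def set_assign_def seq_def assumption2_def demonic_update_def
      set_assign_rel_def subst_def le_fun_def)

lemma is_statement_mono:
  assumes "is_statement S" "q \<le> q'" "r \<le> r'"
  shows "S q r \<le> S q' r'"
  using assms by (simp add: is_statement_def)

text \<open>An exception in \<open>T\<close> must establish \<open>p \<squnion> r\<close> with
  \<open>p\<close> the precondition of the whole composition, not \<open>h \<squnion> r\<close>;
  hence the total assertion for \<open>T\<close>.\<close>

lemma partial_correct_seq:
  assumes "is_statement S"
  shows "partial_correct p (seq S T) q r \<longleftrightarrow>
    (\<exists>h. partial_correct p S h r \<and> total_correct h T q (p \<squnion> r))" (is "?L \<longleftrightarrow> ?R")
proof
  assume "?L"
  \<comment> \<open>The witness is \<open>h = T q (p \<squnion> r)\<close>, the weakest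
    \<open>h\<close> that the assertion about \<open>T\<close> permits.\<close>
  then show "?R"
    by (auto simp: partial_correct_def total_correct_def seq_def)
next
  assume "?R"
  then obtain h where h: "p \<le> S h (p \<squnion> r)" "h \<le> T q (p \<squnion> r)"
    by (auto simp: partial_correct_def total_correct_def)
  note h(1)
  also have "S h (p \<squnion> r) \<le> S (T q (p \<squnion> r)) (p \<squnion> r)"
    using assms h(2) order.refl by (rule is_statement_mono)
  finally show "?L"
    by (simp add: partial_correct_def seq_def)
qed

text \<open>Here \<open>h\<close> links the exceptional exit of \<open>S\<close> to the handler
  \<open>T\<close>, so monotonicity is used in the second argument of \<open>S\<close>. The witness
  is again \<open>T q (p \<squnion> r)\<close>.\<close>

lemma partial_correct_try_catch:
  assumes "is_statement S"
  shows "partial_correct p (try_catch S T) q r \<longleftrightarrow>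
    (\<exists>h. total_correct p S q h \<and> total_correct h T q (p \<squnion> r))" (is "?L \<longleftrightarrow> ?R")
proof
  assume "?L"
  then show "?R"
    by (auto simp: partial_correct_def total_correct_def try_catch_def exc_seq_def)
next
  assume "?R"
  then obtain h where h: "p \<le> S q h" "h \<le> T q (p \<squnion> r)"
    by (auto simp: partial_correct_def total_correct_def)
  note h(1)
  also have "S q h \<le> S q (T q (p \<squnion> r))"
    using assms order.refl h(2) by (rule is_statement_mono)
  finally show "?L"
    by (simp add: partial_correct_def try_catch_def exc_seq_def)
qed

lemma partial_correct_choice:
  "partial_correct p (choice S T) q r \<longleftrightarrow> partial_correct p S q r \<and> partial_correct p T q r"
  by (simp add: partial_correct_def choice_def)

text \<open>The guards strengthen the precondition of each branch, while an exception in a branch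
  may still fall back on the original \<open>p\<close>. Total assertions with
  \<open>p \<squnion> r\<close> express this; partial ones would put the strengthened precondition
  in place of \<open>p\<close>.\<close>

lemma partial_correct_cond:
  "partial_correct p (cond B S T) q r \<longleftrightarrow>
     total_correct (pdef B \<sqinter> pval B \<sqinter> p) S q (p \<squnion> r) \<and>
     total_correct (pdef B \<sqinter> - pval B \<sqinter> p) T q (p \<squnion> r)"
  unfolding partial_correct_def total_correct_def cond_def seq_def choice_def assumption1_def
    assumption2_def le_fun_def
  by auto

theorem theorem3:
  shows
    "(\<forall>(p :: 'd pred) (q :: 'c pred) r.
        partial_correct p abort q r \<longleftrightarrow> p = \<bottom>) \<and>
     (\<forall>(p :: 'd pred) (q :: 'c pred) r.
        partial_correct p stop q r \<longleftrightarrow> True) \<and>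
     (\<forall>(p :: 'd pred) q r.
        partial_correct p skip q r \<longleftrightarrow> p \<le> q) \<and>
     (\<forall>(p :: 'd pred) (q :: 'c pred) r.
        partial_correct p raise q r \<longleftrightarrow> True) \<and>
     (\<forall>(p :: ('x \<times> 'y) pred) q r (E :: ('x \<times> 'y, 'x) pexpr).
        partial_correct p (assign E) q r \<longleftrightarrow> pdef E \<sqinter> p \<le> subst q (pval E)) \<and>
     (\<forall>(p :: ('x \<times> 'y) pred) q r (ES :: ('x \<times> 'y, 'x set) pexpr).
        partial_correct p (set_assign ES) q r \<longleftrightarrow>
          pdef ES \<sqinter> p \<le> (\<lambda>\<sigma>. \<forall>x' \<in> pval ES \<sigma>. subst q (\<lambda>_. x') \<sigma>)) \<and>
     (\<forall>(p :: 'd pred) (q :: 'c pred) r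
        (S :: ('m, 'd, 'd) ptrans) (T :: ('c, 'd, 'm) ptrans).
        is_statement S \<longrightarrow> is_statement T \<longrightarrow>
        (partial_correct p (seq S T) q r \<longleftrightarrow>
          (\<exists>h. partial_correct p S h r \<and> total_correct h T q (p \<squnion> r)))) \<and>
     (\<forall>(p :: 'd pred) (q :: 'c pred) r
        (S :: ('c, 'm, 'd) ptrans) (T :: ('c, 'd, 'm) ptrans).
        is_statement S \<longrightarrow> is_statement T \<longrightarrow>
        (partial_correct p (try_catch S T) q r \<longleftrightarrow>
          (\<exists>h. total_correct p S q h \<and> total_correct h T q (p \<squnion> r)))) \<and>
     (\<forall>(p :: 'd pred) (q :: 'c pred) r
        (S :: ('c, 'd, 'd) ptrans) (T :: ('c, 'd, 'd) ptrans).
        is_statement S \<longrightarrow> is_statement T \<longrightarrow>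
        (partial_correct p (choice S T) q r \<longleftrightarrow>
          partial_correct p S q r \<and> partial_correct p T q r)) \<and>
     (\<forall>(p :: 'd pred) (q :: 'c pred) r (B :: ('d, bool) pexpr)
        (S :: ('c, 'd, 'd) ptrans) (T :: ('c, 'd, 'd) ptrans).
        is_statement S \<longrightarrow> is_statement T \<longrightarrow>
        (partial_correct p (cond B S T) q r \<longleftrightarrow>
          total_correct (pdef B \<sqinter> pval B \<sqinter> p) S q (p \<squnion> r) \<and>
          total_correct (pdef B \<sqinter> - pval B \<sqinter> p) T q (p \<squnion> r)))"
  by (intro conjI allI impI)
    (simp_all only: partial_correct_abort partial_correct_stop partial_correct_skip
      partial_correct_raise partial_correct_assign partial_correct_set_assign
      partial_correct_seq partial_correct_try_catch partial_correct_choice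
      partial_correct_cond)

end
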